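(* Let $a,b,c,c_1,c_2\in\mathbb{R}$ with $b>0$, let $z=z(u)$ be a smooth real function of $u>0$, and let $M^2_{(a,b,c,c_1,c_2)}$ be the parabolic revolution surface $$\mathbf{P}(u,t)=\Big(at+u,\;bt,\;ct+\tfrac{ac_1+bc_2}{2}t^2+c_1ut+z(u)\Big),\qquad u>0,\ t\in\mathbb{R},$$ in simply isotropic space, with generating curve $\alpha(u)=(u,0,z(u))$ and parabolic Gauss map $\mathbf{G}=(G^1,G^2,G^3)$. Suppose that the top-view projection of $\mathbf{G}$ is of coordinate finite-type with $\lambda=\lambda_1=\lambda_2\neq0$, i.e. there is a real $\lambda\neq0$ with $-\Delta G^1=\lambda G^1$ and $-\Delta G^2=\lambda G^2$. If, in addition, the third coordinate $G^3$ is a non-zero eigenfunction, i.e. $G^3\not\equiv0$ and $-\Delta G^3=\lambda_3G^3$ for some $\lambda_3\in\mathbb{R}$, then $M^2_{(a,b,c,c_1,c_2)}=M^2_{(a,b,0,0,0)}$ (that is, $c=c_1=c_2=0$) and the surface belongs to one of the following families: (1) If $\lambda_3=0$, then $z(u)=z_0$ is constant. (2) If $\lambda_3\neq0$, then $\lambda_3=4\lambda$ and $$z(u)=\begin{cases}z_0+\sqrt{\frac{2}{\lambda}}\,\sin(\sqrt{\Lambda}\,u+\phi_0)&\text{if }\lambda>0,\\[4pt] z_0+\sqrt{-\frac{2}{\lambda}}\,\sinh(\sqrt{-\Lambda}\,u+\phi_0)&\text{if }\lambda<0,\end{cases}$$ where $z_0$ and $\phi_0$ are constants and $\Lambda=\lambda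 b^2/(a^2+b^2)$.
   Context: Simply isotropic space $\mathbb{I}^3$ is $\mathbb{R}^3$ with the degenerate inner product $\langle X,Y\rangle=x_1y_1+x_2y_2$. For an admissible surface $\mathbf{x}(u^1,u^2)$ (one whose induced metric $g_{ij}=\langle\mathbf{x}_i,\mathbf{x}_j\rangle$, with $\mathbf{x}_i=\partial\mathbf{x}/\partial u^i$, has rank 2), write $(\mathbf{x}_1\times\mathbf{x}_2)/X_{12}=(N^1,N^2,1)$, where $\times$ is the Euclidean cross product and $X_{12}$ is the third coordinate of $\mathbf{x}_1\times\mathbf{x}_2$. The parabolic normal (parabolic Gauss map) is $\mathbf{G}=\big(N^1,N^2,\tfrac12-\tfrac12[(N^1)^2+(N^2)^2]\big)$, and its top-view projection is given by its first two coordinates $(G^1,G^2)$. $\Delta$ is the Laplace-Beltrami operator of $g_{ij}$. For the parabolic revolution surface $\mathbf{P}$, $$G^1=-c_1t-z',\qquad G^2=\frac{az'-c-bc_2t-c_1u}{b},\qquad G^3=\tfrac12-\tfrac12\big[(G^1)^2+(G^2)^2\big],$$ $$\Delta=\frac{a^2+b^2}{b^2}\frac{\partial^2}{\partial u^2}-\frac{2a}{b^2}\frac{\partial^2}{\partial u\,\partial t}+\frac1{b^2}\frac{\partial^2}{\partial t^2}.$$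
   Formalization: For λ<0 the formula needs a sign ±1 before √(-2/λ) sinh(√(-Λ)u+φ₀), and the theorem is proved with it: with a=0, b=1, c=c₁=c₂=0, λ=-2, λ₃=-8, the function z=-sinh(√2 u) meets every hypothesis but is decreasing, so it is not in the printed family. *)

theory Defs
  imports "HOL-Analysis.Analysis"
begin

text \<open>
  A parametrised surface is a map \<open>x :: real^2 \<Rightarrow> real^3\<close>; the two components of a parameter point
  are $(u^1,u^2)$, and \<open>x\<close> is only meaningful on an open parameter domain.
\<close>

definition partial :: "2 \<Rightarrow> (real^2 \<Rightarrow> 'a::real_normed_vector) \<Rightarrow> real^2 \<Rightarrow> 'a" where
  "partial i f p = vector_derivative (\<lambda>s. f (p + s *\<^sub>R axis i 1)) (at 0)"

definition iso_inner :: "real^3 \<Rightarrow> real^3 \<Rightarrow> real" where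
  "iso_inner X Y = X$1 * Y$1 + X$2 * Y$2"

definition iso_metric :: "(real^2 \<Rightarrow> real^3) \<Rightarrow> real^2 \<Rightarrow> real^2^2" where
  "iso_metric x p = (\<chi> i j. iso_inner (partial i x p) (partial j x p))"

text \<open>
  The determinant of \<^const>\<open>iso_metric\<close> is the square of the third coordinate of \<open>x\<^sub>1 \<times> x\<^sub>2\<close>,
  so the two divisions below are meaningful exactly when the surface is admissible.
\<close>

definition parabolic_gauss :: "(real^2 \<Rightarrow> real^3) \<Rightarrow> real^2 \<Rightarrow> real^3" where
  "parabolic_gauss x p =
     (let X = cross3 (partial 1 x p) (partial 2 x p);
          N1 = X$1 / X$3;
          N2 = X$2 / X$3
      in vector [N1, N2, 1/2 - 1/2 * (N1\<^sup>2 + N2\<^sup>2)])"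

definition laplace_beltrami ::
  "(real^2 \<Rightarrow> real^3) \<Rightarrow> (real^2 \<Rightarrow> real) \<Rightarrow> real^2 \<Rightarrow> real" where
  "laplace_beltrami x f p =
     (\<Sum>i\<in>UNIV. partial i
        (\<lambda>q. sqrt (det (iso_metric x q)) *
             (\<Sum>j\<in>UNIV. matrix_inv (iso_metric x q) $ i $ j * partial j f q)) p)
     / sqrt (det (iso_metric x p))"

text \<open>Smoothness on an open set of reals: all iterated derivatives exist there.\<close>

definition smooth_on :: "real set \<Rightarrow> (real \<Rightarrow> real) \<Rightarrow> bool" where
  "smooth_on S f \<longleftrightarrow> (\<forall>n. \<forall>u\<in>S. (deriv ^^ n) f differentiable (at u))"

text \<open>The parameter point is $(u,t)$; the surface is considered for $u>0$ only.\<close>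

definition parabolic_revolution ::
  "real \<Rightarrow> real \<Rightarrow> real \<Rightarrow> real \<Rightarrow> real \<Rightarrow> (real \<Rightarrow> real) \<Rightarrow> real^2 \<Rightarrow> real^3" where
  "parabolic_revolution a b c c1 c2 z p =
     (let u = p$1; t = p$2
      in vector [a * t + u, b * t,
                 c * t + (a * c1 + b * c2) / 2 * t\<^sup>2 + c1 * u * t + z u])"

definition param_domain :: "(real^2) set" where
  "param_domain = {p. p$1 > 0}"

definition laplace_eigen ::
  "(real^2 \<Rightarrow> real^3) \<Rightarrow> (real^2) set \<Rightarrow> (real^2 \<Rightarrow> real) \<Rightarrow> real \<Rightarrow> bool" where
  "laplace_eigen x D f \<mu> \<longleftrightarrow> (\<forall>p\<in>D. - laplace_beltrami x f p = \<mu> * f p)"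

end

theory Submission
  imports Defs
begin

text \<open>
  The isotropic metric ignores the third coordinate of the surface, and the first two coordinates
  of the parabolic revolution surface are linear in the parameters.  Its metric is therefore
  constant, and its Laplacian is an operator with constant coefficients
  (\<open>laplace_beltrami_parabolic_revolution\<close>), so that the three eigenvalue equations become
  identities between a polynomial in $t$ and derivatives of $w = z'$.

  Write $k = (a^2+b^2)/b^2$ and $\<Lambda> = \<lambda>/k$.  The equation for $G^1$ is
  $k w'' = -\<lambda>(c_1 t + w)$ for all $t$, so $c_1 = 0$ and $w'' = -\<Lambda> w$.  With this, the terms in
  $w$ cancel from the equation for $G^2$, and $c + b c_2 t = 0$ remains for all $t$; hence
  $c = c_2 = 0$.  Now $G^3 = \frac12 - \frac k2 w^2$, and its equation, after elimination of $w''$,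
  is a first-order relation
  \[ w'^2 = \frac{\<lambda>_3}{2k^2} + \Big(\<Lambda> - \frac{\<lambda>_3}{2k}\Big) w^2. \]
  But the oscillator $w'' = -\<Lambda> w$ conserves $w'^2 + \<Lambda> w^2$ and, up to scaling, no other
  linear combination of $w'^2$ and $w^2$, unless $w = 0$ (\<open>energy_rigidity\<close>).  So either $z$ is constant, which
  forces $\<lambda>_3 = 0$, or the coefficient of $w^2$ is $-\<Lambda>$, that is $\<lambda>_3 = 4\<lambda>$.

  In the second case $z + w'/\<Lambda>$ is a constant $z_0$, and $y = z - z_0$ solves the same oscillator
  equation with known energy $y'^2/\<Lambda> + y^2 = 2/\<lambda>$.  The equation fixes $y$ up to two
  constants and the energy fixes the amplitude, so only a phase is free.  If $\<lambda> < 0$ the energy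
  relation is a hyperbola instead of a circle; its two branches account for the sign in front of
  $\sinh$.
\<close>

section \<open>Coordinate partial derivatives\<close>

text \<open>
  Maps known only on the parameter domain suffice for computing a partial derivative there, because
  the domain is open.  The representation by a curried
  function \<open>F\<close> of $(u,t)$ reduces the computation to one-variable calculus.
\<close>

lemma partial_1_eqI:
  fixes f :: "real^2 \<Rightarrow> 'a::real_normed_vector"
  assumes p: "p \<in> param_domain"
    and f: "\<And>q. q \<in> param_domain \<Longrightarrow> f q = F (q$1) (q$2)"
    and F: "((\<lambda>u. F u (p$2)) has_vector_derivative d) (at (p$1))"
  shows "partial 1 f p = d"
proof -
  have "((\<lambda>u. F u (p$2)) has_vector_derivative d) (at (p$1 + 0))"
    using F by simp
  moreover have "((\<lambda>s. p$1 + s) has_vector_derivative 1) (at 0)"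
    by (auto intro!: derivative_eq_intros)
  ultimately have "((\<lambda>s. F (p$1 + s) (p$2)) has_vector_derivative d) (at 0)"
    using vector_diff_chain_at[of "\<lambda>s. p$1 + s" 1 0 "\<lambda>u. F u (p$2)" d]
    by (simp add: o_def)
  then have "((\<lambda>s. f (p + s *\<^sub>R axis 1 1)) has_vector_derivative d) (at 0)"
  proof (rule has_vector_derivative_transform_within_open)
    \<comment> \<open>the steps that keep the point inside the half-plane\<close>
    show "open {s. - p$1 < s}" "0 \<in> {s. - p$1 < s}"
      using p by (auto simp: param_domain_def open_Collect_less)
    show "F (p$1 + s) (p$2) = f (p + s *\<^sub>R axis 1 1)" if "s \<in> {s. - p$1 < s}" for s
      using that by (subst f) (auto simp: param_domain_def axis_def)
  qed
  then show ?thesis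
    by (simp add: partial_def vector_derivative_at)
qed

lemma partial_2_eqI:
  fixes f :: "real^2 \<Rightarrow> 'a::real_normed_vector"
  assumes p: "p \<in> param_domain"
    and f: "\<And>q. q \<in> param_domain \<Longrightarrow> f q = F (q$1) (q$2)"
    and F: "((\<lambda>t. F (p$1) t) has_vector_derivative d) (at (p$2))"
  shows "partial 2 f p = d"
proof -
  have "((\<lambda>t. F (p$1) t) has_vector_derivative d) (at (p$2 + 0))"
    using F by simp
  moreover have "((\<lambda>s. p$2 + s) has_vector_derivative 1) (at 0)"
    by (auto intro!: derivative_eq_intros)
  ultimately have "((\<lambda>s. F (p$1) (p$2 + s)) has_vector_derivative d) (at 0)"
    using vector_diff_chain_at[of "\<lambda>s. p$2 + s" 1 0 "\<lambda>t. F (p$1) t" d]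
    by (simp add: o_def)
  moreover have "F (p$1) (p$2 + s) = f (p + s *\<^sub>R axis 2 1)" for s
    using p by (subst f) (auto simp: param_domain_def axis_def)
  ultimately show ?thesis
    by (simp add: partial_def vector_derivative_at)
qed

lemma has_vector_derivative_vector_3:
  fixes f g h :: "real \<Rightarrow> real"
  assumes "(f has_real_derivative f') (at x)" "(g has_real_derivative g') (at x)"
    "(h has_real_derivative h') (at x)"
  shows "((\<lambda>s. vector [f s, g s, h s] :: real^3) has_vector_derivative vector [f', g', h']) (at x)"
proof -
  have expand: "vector [r, s, t] = r *\<^sub>R axis 1 1 + s *\<^sub>R axis 2 1 + (t *\<^sub>R axis 3 1 :: real^3)"
    for r s t :: real
    by (simp add: vec_eq_iff forall_3 axis_def)
  show ?thesis
    unfolding expand by (auto intro!: derivative_eq_intros assms)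
qed

lemma smooth_onD:
  assumes "smooth_on S z" "u \<in> S"
  shows "((deriv ^^ n) z has_real_derivative (deriv ^^ Suc n) z u) (at u)"
proof -
  have "(deriv ^^ n) z differentiable (at u)"
    using assms by (simp add: smooth_on_def)
  then have "(deriv ^^ n) z field_differentiable (at u)"
    by (simp add: field_differentiable_def real_differentiable_def)
  then show ?thesis
    by (simp add: field_differentiable_derivI)
qed

section \<open>Geometry of the parabolic revolution surface\<close>

context
  fixes a b c c1 c2 :: real and z :: "real \<Rightarrow> real" and P :: "real^2 \<Rightarrow> real^3"
  assumes b: "b > 0" and smooth: "smooth_on {0<..} z"
  defines "P \<equiv> parabolic_revolution a b c c1 c2 z"
begin

lemma partial_1_parabolic_revolution:
  assumes p: "p \<in> param_domain"
  shows "partial 1 P p = vector [1, 0, c1 * p$2 + deriv z (p$1)]"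
proof (rule partial_1_eqI[OF p, where F = "\<lambda>u t. vector [a * t + u, b * t,
      c * t + (a * c1 + b * c2) / 2 * t\<^sup>2 + c1 * u * t + z u]"])
  have "(z has_real_derivative deriv z (p$1)) (at (p$1))"
    using smooth_onD[OF smooth, of "p$1" 0] p by (simp add: param_domain_def)
  then show "((\<lambda>u. vector [a * p$2 + u, b * p$2,
      c * p$2 + (a * c1 + b * c2) / 2 * (p$2)\<^sup>2 + c1 * u * p$2 + z u] :: real^3)
      has_vector_derivative vector [1, 0, c1 * p$2 + deriv z (p$1)]) (at (p$1))"
    by (intro has_vector_derivative_vector_3) (auto intro!: derivative_eq_intros)
qed (simp add: P_def parabolic_revolution_def Let_def)

lemma partial_2_parabolic_revolution:
  assumes p: "p \<in> param_domain"
  shows "partial 2 P p = vector [a, b, c + (a * c1 + b * c2) * p$2 + c1 * p$1]"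
proof (rule partial_2_eqI[OF p, where F = "\<lambda>u t. vector [a * t + u, b * t,
      c * t + (a * c1 + b * c2) / 2 * t\<^sup>2 + c1 * u * t + z u]"])
  show "((\<lambda>t. vector [a * t + p$1, b * t,
      c * t + (a * c1 + b * c2) / 2 * t\<^sup>2 + c1 * p$1 * t + z (p$1)] :: real^3)
      has_vector_derivative vector [a, b, c + (a * c1 + b * c2) * p$2 + c1 * p$1]) (at (p$2))"
    by (intro has_vector_derivative_vector_3) (auto intro!: derivative_eq_intros)
qed (simp add: P_def parabolic_revolution_def Let_def)

lemma parabolic_gauss_parabolic_revolution:
  assumes p: "p \<in> param_domain"
  defines "N1 \<equiv> - c1 * p$2 - deriv z (p$1)"
    and "N2 \<equiv> (a * deriv z (p$1) - c - b * c2 * p$2 - c1 * p$1) / b"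
  shows "parabolic_gauss P p $ 1 = N1" "parabolic_gauss P p $ 2 = N2"
    "parabolic_gauss P p $ 3 = 1/2 - 1/2 * (N1\<^sup>2 + N2\<^sup>2)"
proof -
  define X where "X = cross3 (partial 1 P p) (partial 2 P p)"
  have "X$1 / X$3 = N1" "X$2 / X$3 = N2"
    unfolding X_def N1_def N2_def partial_1_parabolic_revolution[OF p]
      partial_2_parabolic_revolution[OF p]
    using b by (simp_all add: cross3_def field_simps)
  then show "parabolic_gauss P p $ 1 = N1" "parabolic_gauss P p $ 2 = N2"
    "parabolic_gauss P p $ 3 = 1/2 - 1/2 * (N1\<^sup>2 + N2\<^sup>2)"
    by (simp_all add: parabolic_gauss_def X_def[symmetric] Let_def)
qed

lemma iso_metric_parabolic_revolution:
  assumes "p \<in> param_domain"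
  shows "iso_metric P p = vector [vector [1, a], vector [a, a\<^sup>2 + b\<^sup>2]]"
  using assms
  by (simp add: iso_metric_def iso_inner_def vec_eq_iff forall_2 power2_eq_square
      partial_1_parabolic_revolution partial_2_parabolic_revolution)

lemma matrix_inv_iso_metric:
  assumes p: "p \<in> param_domain"
  shows "matrix_inv (iso_metric P p)
    = vector [vector [(a\<^sup>2 + b\<^sup>2) / b\<^sup>2, - a / b\<^sup>2], vector [- a / b\<^sup>2, 1 / b\<^sup>2]]"
    (is "_ = ?B")
proof -
  have "iso_metric P p ** ?B = mat 1"
    using b unfolding iso_metric_parabolic_revolution[OF p]
    by (simp add: matrix_matrix_mult_def vec_eq_iff forall_2 sum_2 mat_def field_simps
        power2_eq_square)
  then have inverse: "iso_metric P p ** ?B = mat 1" "?B ** iso_metric P p = mat 1"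
    by (simp_all add: matrix_left_right_inverse)
  have "A = ?B" if "A ** iso_metric P p = mat 1" for A
  proof -
    have "A = A ** (iso_metric P p ** ?B)"
      by (simp only: inverse matrix_mul_rid)
    also have "\<dots> = ?B"
      by (simp only: matrix_mul_assoc that matrix_mul_lid)
    finally show ?thesis .
  qed
  then show ?thesis
    unfolding matrix_inv_def by (intro some_equality conjI inverse) blast
qed

lemma sqrt_det_iso_metric:
  assumes p: "p \<in> param_domain"
  shows "sqrt (det (iso_metric P p)) = b"
  using b unfolding iso_metric_parabolic_revolution[OF p]
  by (simp add: det_2 power2_eq_square)

text \<open>
  The volume density $b$ and the inverse metric are constant on the domain, so the divergence only
  meets the partial derivatives of the function.  The symmetry of the second derivatives enters as
  the common value \<open>Fut\<close> of the two mixed ones; for the explicit components of the Gauss map it is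
  visible.
\<close>

lemma laplace_beltrami_parabolic_revolution:
  assumes p: "p \<in> param_domain"
    and f: "\<And>q. q \<in> param_domain \<Longrightarrow> f q = F (q$1) (q$2)"
    and Fu: "\<And>u t. u > 0 \<Longrightarrow> ((\<lambda>u. F u t) has_real_derivative Fu u t) (at u)"
    and Ft: "\<And>u t. u > 0 \<Longrightarrow> ((\<lambda>t. F u t) has_real_derivative Ft u t) (at t)"
    and Fuu: "((\<lambda>u. Fu u (p$2)) has_real_derivative Fuu) (at (p$1))"
    and Fut: "((\<lambda>t. Fu (p$1) t) has_real_derivative Fut) (at (p$2))"
    and Ftu: "((\<lambda>u. Ft u (p$2)) has_real_derivative Fut) (at (p$1))"
    and Ftt: "((\<lambda>t. Ft (p$1) t) has_real_derivative Ftt) (at (p$2))"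
  shows "laplace_beltrami P f p = ((a\<^sup>2 + b\<^sup>2) * Fuu - 2 * a * Fut + Ftt) / b\<^sup>2"
proof -
  have f1: "partial 1 f q = Fu (q$1) (q$2)" if "q \<in> param_domain" for q
    using that Fu by (intro partial_1_eqI[where F = F] f)
      (auto simp: has_real_derivative_iff_has_vector_derivative param_domain_def)
  have f2: "partial 2 f q = Ft (q$1) (q$2)" if "q \<in> param_domain" for q
    using that Ft by (intro partial_2_eqI[where F = F] f)
      (auto simp: has_real_derivative_iff_has_vector_derivative param_domain_def)
  \<comment> \<open>the components of the gradient, multiplied by the volume density\<close>
  define flux1 where "flux1 u t = b * ((a\<^sup>2 + b\<^sup>2) / b\<^sup>2 * Fu u t + - a / b\<^sup>2 * Ft u t)" for u t
  define flux2 where "flux2 u t = b * (- a / b\<^sup>2 * Fu u t + 1 / b\<^sup>2 * Ft u t)" for u t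
  let ?flux = "\<lambda>i q. sqrt (det (iso_metric P q)) *
             (\<Sum>j\<in>UNIV. matrix_inv (iso_metric P q) $ i $ j * partial j f q)"
  have flux1: "partial 1 (?flux 1) p = b * ((a\<^sup>2 + b\<^sup>2) / b\<^sup>2 * Fuu + - a / b\<^sup>2 * Fut)"
  proof (rule partial_1_eqI[OF p, where F = flux1])
    show "?flux 1 q = flux1 (q$1) (q$2)" if "q \<in> param_domain" for q
      using that by (simp add: sqrt_det_iso_metric matrix_inv_iso_metric sum_2 f1 f2 flux1_def)
    show "((\<lambda>u. flux1 u (p$2)) has_vector_derivative
        b * ((a\<^sup>2 + b\<^sup>2) / b\<^sup>2 * Fuu + - a / b\<^sup>2 * Fut)) (at (p$1))"
      unfolding flux1_def has_real_derivative_iff_has_vector_derivative[symmetric]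
      by (intro DERIV_cmult DERIV_add Fuu Ftu)
  qed
  have flux2: "partial 2 (?flux 2) p = b * (- a / b\<^sup>2 * Fut + 1 / b\<^sup>2 * Ftt)"
  proof (rule partial_2_eqI[OF p, where F = flux2])
    show "?flux 2 q = flux2 (q$1) (q$2)" if "q \<in> param_domain" for q
      using that by (simp add: sqrt_det_iso_metric matrix_inv_iso_metric sum_2 f1 f2 flux2_def)
    show "((\<lambda>t. flux2 (p$1) t) has_vector_derivative
        b * (- a / b\<^sup>2 * Fut + 1 / b\<^sup>2 * Ftt)) (at (p$2))"
      unfolding flux2_def has_real_derivative_iff_has_vector_derivative[symmetric]
      by (intro DERIV_cmult DERIV_add Fut Ftt)
  qed
  have collect: "b * (A / n * Fuu + - a / n * Fut) + b * (- a / n * Fut + 1 / n * Ftt)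
      = b * ((A * Fuu - 2 * a * Fut + Ftt) / n)" for A n
    by (simp add: divide_inverse algebra_simps)
  show ?thesis
    unfolding laplace_beltrami_def sum_2[of "\<lambda>i. partial i (?flux i) p"] flux1 flux2
      sqrt_det_iso_metric[OF p] collect
    using b by simp
qed

end

section \<open>Linear oscillators with prescribed energy\<close>

lemma constant_on_half_line:
  fixes f :: "real \<Rightarrow> real"
  assumes "\<And>u. u > 0 \<Longrightarrow> (f has_real_derivative 0) (at u)"
  shows "\<exists>k. \<forall>u>0. f u = k"
proof -
  have "\<exists>k. \<forall>u\<in>{0<..}. f u = k"
    by (rule has_field_derivative_zero_constant)
      (auto intro: has_field_derivative_at_within assms)
  then show ?thesis by auto
qed

lemma derivative_of_constant_on_half_line:
  fixes f :: "real \<Rightarrow> real"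
  assumes f: "\<And>u. u > 0 \<Longrightarrow> f u = k" and d: "(f has_real_derivative d) (at v)" and v: "v > 0"
  shows "d = 0"
proof -
  have "(f has_real_derivative 0) (at v)"
    by (rule has_field_derivative_transform_within_open[where f = "\<lambda>_. k" and S = "{0<..}"])
      (use f v in auto)
  with d show ?thesis
    by (rule DERIV_unique)
qed

text \<open>
  Rotating the phase-space point $(y, w/\<omega>)$ back by the angle $\<omega> u$ gives a point that does not
  move.  It lies on the circle whose radius the energy prescribes, and its angle, measured from
  the second axis, is the phase.
\<close>

lemma harmonic_oscillator_amplitude_phase:
  fixes y w :: "real \<Rightarrow> real"
  assumes y: "\<And>u. u > 0 \<Longrightarrow> (y has_real_derivative w u) (at u)"
    and w: "\<And>u. u > 0 \<Longrightarrow> (w has_real_derivative - \<omega>\<^sup>2 * y u) (at u)"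
    and \<omega>: "\<omega> > 0" and R: "R > 0"
    and energy: "\<And>u. u > 0 \<Longrightarrow> (w u / \<omega>)\<^sup>2 + (y u)\<^sup>2 = R\<^sup>2"
  shows "\<exists>\<phi>. \<forall>u>0. y u = R * sin (\<omega> * u + \<phi>)"
proof -
  have "((\<lambda>u. y u * cos (\<omega> * u) - w u / \<omega> * sin (\<omega> * u)) has_real_derivative 0) (at u)"
    if "u > 0" for u
    using \<omega> by (auto intro!: derivative_eq_intros y[OF that] w[OF that] simp: field_simps power2_eq_square)
  then have "\<exists>p. \<forall>u>0. y u * cos (\<omega> * u) - w u / \<omega> * sin (\<omega> * u) = p"
    by (rule constant_on_half_line)
  then obtain p where p: "\<And>u. u > 0 \<Longrightarrow> y u * cos (\<omega> * u) - w u / \<omega> * sin (\<omega> * u) = p"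
    by blast
  have "((\<lambda>u. y u * sin (\<omega> * u) + w u / \<omega> * cos (\<omega> * u)) has_real_derivative 0) (at u)"
    if "u > 0" for u
    using \<omega> by (auto intro!: derivative_eq_intros y[OF that] w[OF that] simp: field_simps power2_eq_square)
  then have "\<exists>q. \<forall>u>0. y u * sin (\<omega> * u) + w u / \<omega> * cos (\<omega> * u) = q"
    by (rule constant_on_half_line)
  then obtain q where q: "\<And>u. u > 0 \<Longrightarrow> y u * sin (\<omega> * u) + w u / \<omega> * cos (\<omega> * u) = q"
    by blast
  have y_eq: "y u = p * cos (\<omega> * u) + q * sin (\<omega> * u)" if "u > 0" for u
  proof -
    have "p * cos (\<omega> * u) + q * sin (\<omega> * u) = y u * ((sin (\<omega> * u))\<^sup>2 + (cos (\<omega> * u))\<^sup>2)"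
      unfolding p[OF that, symmetric] q[OF that, symmetric] by algebra
    then show ?thesis by simp
  qed
  have "p\<^sup>2 + q\<^sup>2 = ((w 1 / \<omega>)\<^sup>2 + (y 1)\<^sup>2) * ((sin (\<omega> * 1))\<^sup>2 + (cos (\<omega> * 1))\<^sup>2)"
    unfolding p[OF zero_less_one, symmetric] q[OF zero_less_one, symmetric] by algebra
  then have "p\<^sup>2 + q\<^sup>2 = R\<^sup>2"
    using energy[of 1] by simp
  then have "(q / R)\<^sup>2 + (p / R)\<^sup>2 = 1"
    using R by (simp add: power_divide add_divide_distrib[symmetric] add.commute)
  then obtain \<phi> where "q / R = cos \<phi>" "p / R = sin \<phi>"
    by (metis sincos_total_2pi)
  then have "q = R * cos \<phi>" "p = R * sin \<phi>"
    using R by (simp_all add: field_simps)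
  then show ?thesis
    using y_eq by (intro exI[of _ \<phi>]) (simp add: sin_add algebra_simps)
qed

text \<open>
  The same argument with hyperbolic rotations.  The fixed point $(p,q)$ lies on the hyperbola
  $q^2 - p^2 = R^2$, whose branches are told apart by the sign of $q$; the parametrisation by
  $(\sinh, \cosh)$ reaches only one of them, hence the sign \<open>\<epsilon>\<close>.
\<close>

lemma hyperbolic_oscillator_amplitude_phase:
  fixes y w :: "real \<Rightarrow> real"
  assumes y: "\<And>u. u > 0 \<Longrightarrow> (y has_real_derivative w u) (at u)"
    and w: "\<And>u. u > 0 \<Longrightarrow> (w has_real_derivative \<omega>\<^sup>2 * y u) (at u)"
    and \<omega>: "\<omega> > 0" and R: "R > 0"
    and energy: "\<And>u. u > 0 \<Longrightarrow> (w u / \<omega>)\<^sup>2 - (y u)\<^sup>2 = R\<^sup>2"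
  shows "\<exists>\<phi>. \<exists>\<epsilon>\<in>{-1, 1}. \<forall>u>0. y u = \<epsilon> * R * sinh (\<omega> * u + \<phi>)"
proof -
  have "((\<lambda>u. y u * cosh (\<omega> * u) - w u / \<omega> * sinh (\<omega> * u)) has_real_derivative 0) (at u)"
    if "u > 0" for u
    using \<omega> by (auto intro!: derivative_eq_intros y[OF that] w[OF that] simp: field_simps power2_eq_square)
  then have "\<exists>p. \<forall>u>0. y u * cosh (\<omega> * u) - w u / \<omega> * sinh (\<omega> * u) = p"
    by (rule constant_on_half_line)
  then obtain p where p: "\<And>u. u > 0 \<Longrightarrow> y u * cosh (\<omega> * u) - w u / \<omega> * sinh (\<omega> * u) = p"
    by blast
  have "((\<lambda>u. w u / \<omega> * cosh (\<omega> * u) - y u * sinh (\<omega> * u)) has_real_derivative 0) (at u)"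
    if "u > 0" for u
    using \<omega> by (auto intro!: derivative_eq_intros y[OF that] w[OF that] simp: field_simps power2_eq_square)
  then have "\<exists>q. \<forall>u>0. w u / \<omega> * cosh (\<omega> * u) - y u * sinh (\<omega> * u) = q"
    by (rule constant_on_half_line)
  then obtain q where q: "\<And>u. u > 0 \<Longrightarrow> w u / \<omega> * cosh (\<omega> * u) - y u * sinh (\<omega> * u) = q"
    by blast
  have y_eq: "y u = p * cosh (\<omega> * u) + q * sinh (\<omega> * u)" if "u > 0" for u
  proof -
    have "p * cosh (\<omega> * u) + q * sinh (\<omega> * u) = y u * ((cosh (\<omega> * u))\<^sup>2 - (sinh (\<omega> * u))\<^sup>2)"
      unfolding p[OF that, symmetric] q[OF that, symmetric] by algebra
    then show ?thesis by (simp add: hyperbolic_pythagoras)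
  qed
  have "q\<^sup>2 - p\<^sup>2 = ((w 1 / \<omega>)\<^sup>2 - (y 1)\<^sup>2) * ((cosh (\<omega> * 1))\<^sup>2 - (sinh (\<omega> * 1))\<^sup>2)"
    unfolding p[OF zero_less_one, symmetric] q[OF zero_less_one, symmetric] by algebra
  then have q2: "q\<^sup>2 = R\<^sup>2 + p\<^sup>2"
    using energy[of 1] by (simp add: hyperbolic_pythagoras)
  define \<epsilon> :: real where "\<epsilon> = (if q \<ge> 0 then 1 else -1)"
  define \<phi> where "\<phi> = arsinh (\<epsilon> * p / R)"
  have \<epsilon>: "\<epsilon> \<in> {-1, 1}" "\<epsilon> * \<epsilon> = 1" "\<epsilon> * q = \<bar>q\<bar>"
    by (auto simp: \<epsilon>_def)
  have sinh: "p = \<epsilon> * R * sinh \<phi>"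
    using R \<epsilon> by (auto simp: \<phi>_def)
  have "(R * cosh \<phi>)\<^sup>2 = (R * sinh \<phi>)\<^sup>2 + R\<^sup>2"
    by (simp add: cosh_square_eq power_mult_distrib algebra_simps)
  also have "(R * sinh \<phi>)\<^sup>2 = p\<^sup>2"
    using \<epsilon>(1) sinh by (auto simp: power2_eq_square)
  finally have "(R * cosh \<phi>)\<^sup>2 = \<bar>q\<bar>\<^sup>2"
    using q2 by simp
  then have "\<bar>q\<bar> = R * cosh \<phi>"
    using R by (subst (asm) power2_eq_iff_nonneg) auto
  then have "q = \<epsilon> * R * cosh \<phi>"
    using \<epsilon> by (metis mult.assoc mult_1)
  then show ?thesis
    using y_eq sinh by (intro exI[of _ \<phi>] bexI[OF _ \<epsilon>(1)]) (simp add: sinh_add algebra_simps)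
qed

section \<open>The classification\<close>

text \<open>
  Differentiating the energy relation and inserting the oscillator equation gives
  $2(\<Lambda> + B) w w' = 0$.  If $B \<noteq> -\<Lambda>$, then $w^2$ is constant; a non-zero constant value would
  make $w'$ vanish identically, against $w'' = -\<Lambda> w \<noteq> 0$.
\<close>

lemma energy_rigidity:
  fixes w w' :: "real \<Rightarrow> real"
  assumes w: "\<And>u. u > 0 \<Longrightarrow> (w has_real_derivative w' u) (at u)"
    and w': "\<And>u. u > 0 \<Longrightarrow> (w' has_real_derivative - \<Lambda> * w u) (at u)"
    and "\<Lambda> \<noteq> 0"
    and energy: "\<And>u. u > 0 \<Longrightarrow> (w' u)\<^sup>2 = A + B * (w u)\<^sup>2"
  shows "B = - \<Lambda> \<or> (\<forall>u>0. w u = 0)"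
proof (rule disjCI)
  assume nz: "\<not> (\<forall>u>0. w u = 0)"
  show "B = - \<Lambda>"
  proof (rule ccontr)
    assume "B \<noteq> - \<Lambda>"
    have ww': "w u * w' u = 0" if u: "u > 0" for u
    proof -
      have "((\<lambda>u. (w' u)\<^sup>2 - B * (w u)\<^sup>2) has_real_derivative
          - 2 * (\<Lambda> + B) * (w u * w' u)) (at u)"
        by (auto intro!: derivative_eq_intros w[OF u] w'[OF u] simp: algebra_simps)
      then have "- 2 * (\<Lambda> + B) * (w u * w' u) = 0"
        using u energy by (intro derivative_of_constant_on_half_line[where k = A and v = u]) auto
      then show ?thesis
        using \<open>B \<noteq> - \<Lambda>\<close> by (auto simp: add_eq_0_iff)
    qed
    have "((\<lambda>u. (w u)\<^sup>2) has_real_derivative 0) (at u)" if "u > 0" for u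
      using ww'[OF that] by (auto intro!: derivative_eq_intros w[OF that])
    then have "\<exists>k. \<forall>u>0. (w u)\<^sup>2 = k"
      by (rule constant_on_half_line)
    then obtain k where k: "\<And>u. u > 0 \<Longrightarrow> (w u)\<^sup>2 = k"
      by blast
    have "w u \<noteq> 0" if "u > 0" for u
      using nz k that by (metis zero_eq_power2)
    then have "w' u = 0" if "u > 0" for u
      using ww' that by (metis mult_eq_0_iff)
    then have "- \<Lambda> * w 1 = 0"
      using derivative_of_constant_on_half_line[of w' 0, OF _ w'[of 1]] by simp
    then show False
      using \<open>\<Lambda> \<noteq> 0\<close> \<open>\<And>u. u > 0 \<Longrightarrow> w u \<noteq> 0\<close>[of 1] by simp
  qed
qed

theorem theorem5p3:
  fixes a b c c1 c2 lam lam3 :: real and z :: "real \<Rightarrow> real"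
    and P G :: "real^2 \<Rightarrow> real^3"
  defines "P \<equiv> parabolic_revolution a b c c1 c2 z"
    and "G \<equiv> parabolic_gauss P"
  assumes "b > 0"
    and "smooth_on {0<..} z"
    and "lam \<noteq> 0"
    and "laplace_eigen P param_domain (\<lambda>p. G p $ 1) lam"
    and "laplace_eigen P param_domain (\<lambda>p. G p $ 2) lam"
    and "\<exists>p\<in>param_domain. G p $ 3 \<noteq> 0"
    and "laplace_eigen P param_domain (\<lambda>p. G p $ 3) lam3"
  shows "c = 0 \<and> c1 = 0 \<and> c2 = 0
    \<and> (lam3 = 0 \<longrightarrow> (\<exists>z0. \<forall>u>0. z u = z0))
    \<and> (lam3 \<noteq> 0 \<longrightarrow> lam3 = 4 * lam \<and>
        (let \<Lambda> = lam * b\<^sup>2 / (a\<^sup>2 + b\<^sup>2) in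
           (lam > 0 \<longrightarrow> (\<exists>z0 \<phi>0. \<forall>u>0. z u = z0 + sqrt (2 / lam) * sin (sqrt \<Lambda> * u + \<phi>0)))
         \<and> (lam < 0 \<longrightarrow> (\<exists>z0 \<phi>0. \<exists>\<epsilon>\<in>{-1, 1}. \<forall>u>0.
               z u = z0 + \<epsilon> * sqrt (- 2 / lam) * sinh (sqrt (- \<Lambda>) * u + \<phi>0)))))"
proof -
  note b = assms(3) and smooth = assms(4) and lam = assms(5)
  note gauss = parabolic_gauss_parabolic_revolution[OF b smooth,
      where a = a and c = c and ?c1.0 = c1 and ?c2.0 = c2, folded P_def, folded G_def]
  note laplace = laplace_beltrami_parabolic_revolution[OF b smooth,
      where a = a and c = c and ?c1.0 = c1 and ?c2.0 = c2, folded P_def]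
  define w w' w'' where "w = deriv z" and "w' = deriv w" and "w'' = deriv w'"
  have z: "(z has_real_derivative w u) (at u)"
    and w: "(w has_real_derivative w' u) (at u)"
    and w': "(w' has_real_derivative w'' u) (at u)" if "u > 0" for u
    using smooth_onD[OF smooth, of u 0] smooth_onD[OF smooth, of u 1]
      smooth_onD[OF smooth, of u 2] that
    by (simp_all add: w_def w'_def w''_def numeral_2_eq_2)
  define k where "k = (a\<^sup>2 + b\<^sup>2) / b\<^sup>2"
  have k: "k > 0"
    using b by (simp add: k_def add_nonneg_pos)
  have dom: "vector [u, t] \<in> param_domain \<longleftrightarrow> u > 0" for u t :: real
    by (simp add: param_domain_def)

  have G1: "k * w'' u = lam * (- c1 * t - w u)" if u: "u > 0" for u t
  proof -
    let ?p = "vector [u, t] :: real^2"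
    have "laplace_beltrami P (\<lambda>p. G p $ 1) ?p
        = ((a\<^sup>2 + b\<^sup>2) * (- w'' (?p$1)) - 2 * a * 0 + 0) / b\<^sup>2"
      by (rule laplace[where F = "\<lambda>u t. - c1 * t - w u" and Fu = "\<lambda>u t. - w' u"
            and Ft = "\<lambda>u t. - c1"])
        (use u dom gauss(1) in \<open>auto intro!: derivative_eq_intros w w' simp: w_def[symmetric]\<close>)
    moreover have "- laplace_beltrami P (\<lambda>p. G p $ 1) ?p = lam * G ?p $ 1"
      using assms(6) u dom by (auto simp: laplace_eigen_def)
    ultimately show ?thesis
      using u by (simp add: gauss dom w_def[symmetric] k_def)
  qed
  have G2: "- k * a * w'' u = lam * (a * w u - c - b * c2 * t - c1 * u)" if u: "u > 0" for u t
  proof -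
    let ?p = "vector [u, t] :: real^2"
    have "laplace_beltrami P (\<lambda>p. G p $ 2) ?p
        = ((a\<^sup>2 + b\<^sup>2) * (a * w'' (?p$1) / b) - 2 * a * 0 + 0) / b\<^sup>2"
      by (rule laplace[where F = "\<lambda>u t. (a * w u - c - b * c2 * t - c1 * u) / b"
            and Fu = "\<lambda>u t. (a * w' u - c1) / b" and Ft = "\<lambda>u t. - c2"])
        (use u b dom gauss in \<open>auto intro!: derivative_eq_intros w w' simp: w_def[symmetric]\<close>)
    moreover have "- laplace_beltrami P (\<lambda>p. G p $ 2) ?p = lam * G ?p $ 2"
      using assms(7) u dom by (auto simp: laplace_eigen_def)
    ultimately show ?thesis
      using u b by (simp add: gauss dom w_def[symmetric] k_def field_simps)
  qed

  \<comment> \<open>The left side of \<open>G1\<close> does not depend on \<open>t\<close>, so two values of \<open>t\<close> determine \<open>c1\<close>.\<close>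
  have c1: "c1 = 0"
    using G1[of 1 0] G1[of 1 1] lam by (simp add: algebra_simps)
  have w''_eq: "w'' u = - (lam / k) * w u" if "u > 0" for u
    using G1[OF that, of 0] k by (simp add: field_simps)
  have cc2: "lam * (c + b * c2 * t) = 0" for t
  proof -
    have "k * w'' 1 = - lam * w 1"
      using G1[of 1 0] by simp
    with G2[OF zero_less_one, of t] c1 show ?thesis by algebra
  qed
  have c: "c = 0"
    using cc2[of 0] lam by simp
  have c2: "c2 = 0"
    using cc2[of 1] c lam b by simp

  have G3_eq: "G q $ 3 = 1/2 - k / 2 * (w (q$1))\<^sup>2" if "q \<in> param_domain" for q
    using that b by (simp add: gauss c c1 c2 w_def[symmetric] k_def field_simps)
  have G3: "k\<^sup>2 * ((w' u)\<^sup>2 + w u * w'' u) = lam3 * (1/2 - k / 2 * (w u)\<^sup>2)" if u: "u > 0" for u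
  proof -
    let ?p = "vector [u, 0] :: real^2"
    have "laplace_beltrami P (\<lambda>p. G p $ 3) ?p
        = ((a\<^sup>2 + b\<^sup>2) * (- k * ((w' u)\<^sup>2 + w u * w'' u)) - 2 * a * 0 + 0) / b\<^sup>2"
      by (rule laplace[where F = "\<lambda>u t. 1/2 - k / 2 * (w u)\<^sup>2" and Fu = "\<lambda>u t. - k * (w u * w' u)"
            and Ft = "\<lambda>u t. 0"])
        (use u dom G3_eq in \<open>auto intro!: derivative_eq_intros w w' simp: algebra_simps power2_eq_square\<close>)
    also have "\<dots> = - (k\<^sup>2 * ((w' u)\<^sup>2 + w u * w'' u))"
      by (simp add: k_def power2_eq_square)
    finally have "laplace_beltrami P (\<lambda>p. G p $ 3) ?p = - (k\<^sup>2 * ((w' u)\<^sup>2 + w u * w'' u))" .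
    moreover have "- laplace_beltrami P (\<lambda>p. G p $ 3) ?p = lam3 * G ?p $ 3"
      using assms(9) u dom by (auto simp: laplace_eigen_def)
    ultimately show ?thesis
      using u by (simp add: G3_eq dom)
  qed
  define L where "L = lam / k"
  have L: "L \<noteq> 0" "L = lam * b\<^sup>2 / (a\<^sup>2 + b\<^sup>2)" "lam = k * L"
    using lam k b by (simp_all add: L_def k_def)
  have w'_L: "(w' has_real_derivative - L * w u) (at u)" if "u > 0" for u
    using w'[OF that] w''_eq[OF that] by (simp add: L_def)
  have energy: "(w' u)\<^sup>2 = lam3 / (2 * k\<^sup>2) + (L - lam3 / (2 * k)) * (w u)\<^sup>2" if "u > 0" for u
  proof -
    have "k\<^sup>2 * ((w' u)\<^sup>2 - L * (w u)\<^sup>2) = lam3 * (1/2 - k / 2 * (w u)\<^sup>2)"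
      using G3[OF that] unfolding w''_eq[OF that] L_def by (simp add: power2_eq_square mult_ac)
    then have "(w' u)\<^sup>2 - L * (w u)\<^sup>2 = lam3 * (1/2 - k / 2 * (w u)\<^sup>2) / k\<^sup>2"
      using k by (simp add: eq_divide_eq mult.commute)
    also have "\<dots> = lam3 / (2 * k\<^sup>2) - lam3 / (2 * k) * (w u)\<^sup>2"
      using k by (simp add: right_diff_distrib diff_divide_distrib power2_eq_square)
    finally show ?thesis by (simp add: algebra_simps)
  qed
  have dichotomy: "lam3 = 4 * lam \<or> (\<forall>u>0. w u = 0)"
    using energy_rigidity[OF w w'_L L(1) energy] k by (auto simp: L_def field_simps)

  have flat: "\<exists>z0. \<forall>u>0. z u = z0" if "lam3 = 0"
  proof -
    have "(z has_real_derivative 0) (at u)" if "u > 0" for u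
      using dichotomy \<open>lam3 = 0\<close> lam z[OF that] that by simp
    then show ?thesis
      by (rule constant_on_half_line)
  qed
  have curved: "lam3 = 4 * lam" if "lam3 \<noteq> 0"
  proof (rule ccontr)
    assume "lam3 \<noteq> 4 * lam"
    then have w0: "\<forall>u>0. w u = 0"
      using dichotomy by simp
    then have "w' 1 = 0"
      using derivative_of_constant_on_half_line[of w 0, OF _ w[of 1]] by simp
    then show False
      using energy[of 1] w0 k that by simp
  qed

  \<comment> \<open>The primitive of \<open>w = - w'' / L\<close> that itself satisfies the oscillator equation is \<open>- w' / L\<close>;
    it differs from \<open>z\<close> by the constant \<open>z0\<close>.\<close>
  have "((\<lambda>u. z u + w' u / L) has_real_derivative 0) (at u)" if "u > 0" for u
    using L(1) by (auto intro!: derivative_eq_intros z[OF that] w'_L[OF that])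
  then have "\<exists>z0. \<forall>u>0. z u + w' u / L = z0"
    by (rule constant_on_half_line)
  then obtain z0 where z0: "\<And>u. u > 0 \<Longrightarrow> z u + w' u / L = z0"
    by blast
  define y where "y u = z u - z0" for u
  have y: "(y has_real_derivative w u) (at u)" if "u > 0" for u
    unfolding y_def by (auto intro!: derivative_eq_intros z[OF that])
  have w'_y: "w' u = - L * y u" if "u > 0" for u
    using z0[OF that] L(1) by (auto simp: y_def field_simps)
  have energy': "(w u)\<^sup>2 / L + (y u)\<^sup>2 = 2 / lam" if "u > 0" "lam3 \<noteq> 0" for u
  proof -
    have "(w' u)\<^sup>2 = 2 * L / k - L * (w u)\<^sup>2"
      using energy[OF that(1)] curved[OF that(2)] L(3) k by (simp add: power2_eq_square)
    then have "L * (L * (y u)\<^sup>2) = L * (2 / k - (w u)\<^sup>2)"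
      unfolding w'_y[OF that(1)] by (simp add: power2_eq_square algebra_simps)
    then have "L * (y u)\<^sup>2 = 2 / k - (w u)\<^sup>2"
      using mult_left_cancel[OF L(1)] by blast
    then have "(y u)\<^sup>2 = (2 / k - (w u)\<^sup>2) / L"
      using L(1) by (simp add: eq_divide_eq mult.commute)
    then show ?thesis
      by (simp add: L(3) diff_divide_distrib)
  qed

  have pos: "\<exists>z0 \<phi>0. \<forall>u>0. z u = z0 + sqrt (2 / lam) * sin (sqrt L * u + \<phi>0)"
    if "lam3 \<noteq> 0" "lam > 0"
  proof -
    have "L > 0"
      using that k by (simp add: L_def)
    have "\<exists>\<phi>. \<forall>u>0. y u = sqrt (2 / lam) * sin (sqrt L * u + \<phi>)"
    proof (rule harmonic_oscillator_amplitude_phase[OF y])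
      show "(w has_real_derivative - (sqrt L)\<^sup>2 * y u) (at u)" if "u > 0" for u
        using w[OF that] w'_y[OF that] \<open>L > 0\<close> by simp
      show "(w u / sqrt L)\<^sup>2 + (y u)\<^sup>2 = (sqrt (2 / lam))\<^sup>2" if "u > 0" for u
        using energy'[OF that \<open>lam3 \<noteq> 0\<close>] \<open>L > 0\<close> \<open>lam > 0\<close> by (simp add: power_divide)
    qed (use \<open>L > 0\<close> \<open>lam > 0\<close> in auto)
    then obtain \<phi> where "\<forall>u>0. y u = sqrt (2 / lam) * sin (sqrt L * u + \<phi>)" ..
    then show ?thesis
      by (intro exI[of _ z0] exI[of _ \<phi>]) (simp add: y_def algebra_simps)
  qed
  have neg: "\<exists>z0 \<phi>0. \<exists>\<epsilon>\<in>{-1, 1}. \<forall>u>0.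
      z u = z0 + \<epsilon> * sqrt (- 2 / lam) * sinh (sqrt (- L) * u + \<phi>0)"
    if "lam3 \<noteq> 0" "lam < 0"
  proof -
    have "L < 0"
      using that k by (simp add: L_def divide_neg_pos)
    have "\<exists>\<phi>. \<exists>\<epsilon>\<in>{-1, 1}. \<forall>u>0. y u = \<epsilon> * sqrt (- 2 / lam) * sinh (sqrt (- L) * u + \<phi>)"
    proof (rule hyperbolic_oscillator_amplitude_phase[OF y])
      show "(w has_real_derivative (sqrt (- L))\<^sup>2 * y u) (at u)" if "u > 0" for u
        using w[OF that] w'_y[OF that] \<open>L < 0\<close> by simp
      show "(w u / sqrt (- L))\<^sup>2 - (y u)\<^sup>2 = (sqrt (- 2 / lam))\<^sup>2" if "u > 0" for u
        using energy'[OF that \<open>lam3 \<noteq> 0\<close>] \<open>L < 0\<close> \<open>lam < 0\<close>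
        by (simp add: power_divide divide_nonpos_neg)
    qed (use \<open>L < 0\<close> \<open>lam < 0\<close> in \<open>auto simp: divide_neg_neg\<close>)
    then obtain \<phi> \<epsilon> where "\<epsilon> \<in> {-1, 1}"
      "\<forall>u>0. y u = \<epsilon> * sqrt (- 2 / lam) * sinh (sqrt (- L) * u + \<phi>)" by blast
    then show ?thesis
      by (intro exI[of _ z0] exI[of _ \<phi>] bexI[of _ \<epsilon>]) (simp_all add: y_def algebra_simps)
  qed
  show ?thesis
    unfolding Let_def L(2)[symmetric] using c c1 c2 flat curved pos neg by blast
qed

end
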